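(* Let $N\ge d$, let $s:\mathbb{Z}/d\mathbb{Z}\to\mathbb{Z}/N\mathbb{Z}$ be injective with $\gcd(s(n),N)=1$ for every $n\in\mathbb{Z}/d\mathbb{Z}$, and let $\{x_k\}_{k=0}^{N-1}$ be the DFT frame for $\mathbb{C}^d$ defined by $s$. Let $q\in\ell^2(\mathbb{Z}/N\mathbb{Z}\times\mathbb{Z}/d\mathbb{Z})$ be real valued. Then, for every $u\in\ell^2(\mathbb{Z}/N\mathbb{Z}\times\mathbb{Z}/d\mathbb{Z})$, $$\left(\sum_{m=0}^{N-1}\operatorname{Im}\langle u(m),(q(m)+q(m+1))u(m+1)\rangle\right)^2+\left(\sum_{m=0}^{N-1}\operatorname{Re}\langle u(m),(q(m)-q(m+1))u(m+1)\rangle\right)^2\le\|qu\|^2\,\|(e^1-e^{-1})\widehat{u}\|^2,$$ where $\widehat{u}=\mathcal{F}u$ is the unitary vector-valued DFT of $u$.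
   Context: An element $u\in\ell^2(\mathbb{Z}/N\mathbb{Z}\times\mathbb{Z}/d\mathbb{Z})$ is regarded as a function $u:\mathbb{Z}/N\mathbb{Z}\to\mathbb{C}^d$, with $u(m)(p)\in\mathbb{C}$ the $p$-th coordinate of $u(m)$. Products of vectors in $\mathbb{C}^d$, and of $\mathbb{C}^d$-valued functions on $\mathbb{Z}/N\mathbb{Z}$, are coordinatewise. $\langle\cdot,\cdot\rangle$ is the standard inner product on $\mathbb{C}^d$ (linear in the first argument), and $\|u\|^2=\sum_{m}\sum_p|u(m)(p)|^2$. Indices $m$ are taken modulo $N$. The DFT frame defined by $s$ is $\{x_m\}_{m\in\mathbb{Z}/N\mathbb{Z}}\subseteq\mathbb{C}^d$ with coordinates $x_m(p)=e^{2\pi i m s(p)/N}$, $p\in\mathbb{Z}/d\mathbb{Z}$. For $j\in\mathbb{Z}/N\mathbb{Z}$, the modulation function $e^j:\mathbb{Z}/N\mathbb{Z}\to\mathbb{C}^d$ is $e^j(k)=x_{jk}$. The unitary vector-valued DFT is $(\mathcal{F}u)(n)=\frac{1}{\sqrt N}\sum_{m=0}^{N-1}u(m)x_{-mn}$. *)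

theory Defs
  imports "HOL-Analysis.Analysis"
begin

text \<open>
  Conventions.  A residue class modulo \<open>N\<close> is given by any integer representing it, and a function
  on \<open>\<int>/N\<int>\<close> is an \<open>N\<close>-periodic function on the integers; sums over \<open>\<int>/N\<int>\<close> run over the
  representatives \<open>0, \<dots>, N - 1\<close>.  The group \<open>\<int>/d\<int>\<close> enters only as the index set of the coordinates
  of vectors, so it is rendered by a finite type \<open>'d\<close> with \<open>d = CARD('d)\<close>.  The product \<open>*\<close> on
  \<open>complex ^ 'd\<close> is the coordinatewise one.
\<close>

definition l2 :: "nat \<Rightarrow> (int \<Rightarrow> complex ^ 'd) set" where
  "l2 N = {u. \<forall>m. u (m + int N) = u m}"

definition l2norm :: "nat \<Rightarrow> (int \<Rightarrow> complex ^ 'd::finite) \<Rightarrow> real" where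
  "l2norm N u = sqrt (\<Sum>m\<in>{0..<int N}. \<Sum>p\<in>UNIV. (cmod (u m $ p))\<^sup>2)"

text \<open>The library's inner product on \<open>complex ^ 'd\<close> is the real-valued one.\<close>

definition cinner :: "complex ^ 'd::finite \<Rightarrow> complex ^ 'd \<Rightarrow> complex" where
  "cinner v w = (\<Sum>p\<in>UNIV. v $ p * cnj (w $ p))"

definition dft_frame :: "nat \<Rightarrow> ('d \<Rightarrow> int) \<Rightarrow> int \<Rightarrow> complex ^ 'd::finite" where
  "dft_frame N s m =
     (\<chi> p. exp (2 * of_real pi * \<i> * of_int m * of_int (s p) / of_nat N))"

definition modulation :: "nat \<Rightarrow> ('d \<Rightarrow> int) \<Rightarrow> int \<Rightarrow> int \<Rightarrow> complex ^ 'd::finite" where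
  "modulation N s j k = dft_frame N s (j * k)"

definition vdft ::
    "nat \<Rightarrow> ('d \<Rightarrow> int) \<Rightarrow> (int \<Rightarrow> complex ^ 'd::finite) \<Rightarrow> int \<Rightarrow> complex ^ 'd" where
  "vdft N s u n =
     (1 / sqrt (real N)) *\<^sub>R (\<Sum>m\<in>{0..<int N}. u m * dft_frame N s (- (m * n)))"

end

theory Submission
  imports Defs
begin

text \<open>
  Multiplying \<open>vdft N s u\<close> by \<open>e\<^sup>1 - e\<^sup>-\<^sup>1\<close> gives the transform of the central difference
  \<open>v m = u (m + 1) - u (m - 1)\<close>, so by Parseval the right-hand side is
  \<open>\<parallel>q u\<parallel>\<^sup>2 \<parallel>v\<parallel>\<^sup>2\<close>. Since \<open>q\<close> is real, a cyclic shift of the summation index shows that the two sums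
  on the left are the imaginary and the real part of \<open>\<langle>q u, v\<rangle>\<close>, and Cauchy--Schwarz applies.
\<close>

text \<open>The boundary terms are kept so that induction on \<open>N\<close> works: a function of
  period \<open>Suc N\<close> need not have period \<open>N\<close>. Under periodicity they
  cancel.\<close>

lemma sum_int_shift:
  fixes f :: "int \<Rightarrow> 'a::ab_group_add"
  shows "(\<Sum>m\<in>{0..<int N}. f (m + 1)) = (\<Sum>m\<in>{0..<int N}. f m) + f (int N) - f 0"
proof (induction N)
  case (Suc N)
  have "{0..<int (Suc N)} = insert (int N) {0..<int N}" by auto
  then show ?case using Suc by (simp add: algebra_simps)
qed simp

lemma sum_int_shift_periodic:
  fixes f :: "int \<Rightarrow> 'a::ab_group_add"
  assumes "\<And>m. f (m + int N) = f m"
  shows "(\<Sum>m\<in>{0..<int N}. f (m + 1)) = (\<Sum>m\<in>{0..<int N}. f m)"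
  using assms[of 0] by (simp add: sum_int_shift)

text \<open>The standard character of the integers mod \<open>N\<close>. Coordinate \<open>p\<close>
  of the frame vector x_m is \<open>root_char N (m * s p)\<close>, so the Fourier arguments can be
  carried out one coordinate at a time.\<close>

definition root_char :: "nat \<Rightarrow> int \<Rightarrow> complex" where
  "root_char N k = exp (2 * of_real pi * \<i> * of_int k / of_nat N)"

lemma root_char_add: "root_char N (a + b) = root_char N a * root_char N b"
  by (simp add: root_char_def exp_add[symmetric] add_divide_distrib algebra_simps)

lemma root_char_0 [simp]: "root_char N 0 = 1"
  by (simp add: root_char_def)

lemma cnj_root_char: "cnj (root_char N k) = root_char N (- k)"
  by (simp add: root_char_def exp_cnj)

lemma root_char_eq_1_iff:
  assumes "N > 0"
  shows "root_char N k = 1 \<longleftrightarrow> int N dvd k"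
proof -
  have "2 * pi * real_of_int k / real N = real_of_int (2 * n) * pi
      \<longleftrightarrow> real_of_int k = real_of_int (int N * n)" for n
    using assms by (auto simp: field_simps)
  moreover have "root_char N k = 1 \<longleftrightarrow> (\<exists>n::int. 2 * pi * real_of_int k / real N = real_of_int (2 * n) * pi)"
    by (simp add: root_char_def exp_eq_1)
  ultimately show ?thesis
    by (simp only: of_int_eq_iff dvd_def)
qed

lemma root_char_add_mult:
  assumes "N > 0"
  shows "root_char N (a + int N * b) = root_char N a"
  using root_char_eq_1_iff[OF assms, of "int N * b"] by (simp add: root_char_add)

text \<open>Shifting \<open>n\<close> by one permutes the residues but multiplies the sum by
  \<open>root_char N k\<close>. Hence the sum vanishes unless this factor is 1.\<close>

lemma sum_root_char:
  assumes "N > 0"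
  shows "(\<Sum>n\<in>{0..<int N}. root_char N (k * n)) = (if int N dvd k then of_nat N else 0)"
proof (cases "int N dvd k")
  case True
  then have "root_char N (k * n) = 1" for n
    using root_char_eq_1_iff[OF assms] by (metis dvd_mult2)
  then show ?thesis using True by simp
next
  case False
  let ?S = "\<Sum>n\<in>{0..<int N}. root_char N (k * n)"
  have "root_char N (k * (n + int N)) = root_char N (k * n)" for n
    using root_char_add_mult[OF assms, of "k * n" k] by (simp add: algebra_simps)
  then have "?S = (\<Sum>n\<in>{0..<int N}. root_char N (k * (n + 1)))"
    using sum_int_shift_periodic[of "\<lambda>n. root_char N (k * n)" N] by simp
  also have "\<dots> = root_char N k * ?S"
    by (simp add: distrib_left root_char_add sum_distrib_left mult.commute)
  finally have "(1 - root_char N k) * ?S = 0" by (simp add: algebra_simps)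
  then show ?thesis using False root_char_eq_1_iff[OF assms, of k] by simp
qed

text \<open>Expanding the square leaves a character sum with frequency \<open>(l - m) * c\<close>.
  As \<open>c\<close> is invertible mod \<open>N\<close>, that frequency is 0 mod \<open>N\<close>
  only when \<open>l - m\<close> is, so only the diagonal survives. The transform is not normalised,
  whence the factor \<open>N\<close>.\<close>

lemma parseval_root_char:
  fixes f :: "int \<Rightarrow> complex"
  assumes N: "N > 0" and c: "coprime c (int N)"
  shows "(\<Sum>n\<in>{0..<int N}. (cmod (\<Sum>m\<in>{0..<int N}. f m * root_char N (- (m * n) * c)))\<^sup>2)
       = real N * (\<Sum>m\<in>{0..<int N}. (cmod (f m))\<^sup>2)"
proof -
  let ?I = "{0..<int N}"
  have orth: "(\<Sum>n\<in>?I. root_char N (- (m * n) * c) * cnj (root_char N (- (l * n) * c)))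
      = (if m = l then of_nat N else 0)" if "m \<in> ?I" "l \<in> ?I" for m l
  proof -
    have "(\<Sum>n\<in>?I. root_char N (- (m * n) * c) * cnj (root_char N (- (l * n) * c)))
        = (\<Sum>n\<in>?I. root_char N ((l - m) * c * n))"
      by (simp add: cnj_root_char root_char_add[symmetric] algebra_simps)
    also have "\<dots> = (if int N dvd (l - m) * c then of_nat N else 0)"
      by (rule sum_root_char[OF N])
    also have "int N dvd (l - m) * c \<longleftrightarrow> int N dvd l - m"
      using c by (simp add: coprime_dvd_mult_left_iff coprime_commute)
    \<comment> \<open>Both indices lie in \<open>{0..<int N}\<close>, so congruent ones are
      equal.\<close>
    also have "\<dots> \<longleftrightarrow> m = l"
      using that by (auto simp: mod_eq_dvd_iff[symmetric])
    finally show ?thesis .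
  qed
  \<comment> \<open>Over the complex numbers a squared modulus is z times \<open>cnj z\<close>, so
    the square expands into a double sum.\<close>
  have "complex_of_real (\<Sum>n\<in>?I. (cmod (\<Sum>m\<in>?I. f m * root_char N (- (m * n) * c)))\<^sup>2)
      = (\<Sum>n\<in>?I. \<Sum>m\<in>?I. \<Sum>l\<in>?I. (f m * cnj (f l)) *
          (root_char N (- (m * n) * c) * cnj (root_char N (- (l * n) * c))))"
    unfolding of_real_sum complex_norm_square cnj_sum sum_product complex_cnj_mult
    by (simp only: mult_ac)
  \<comment> \<open>Two swaps make the sum over \<open>n\<close> innermost, where
    \<open>orth\<close> evaluates it.\<close>
  also have "\<dots> = (\<Sum>m\<in>?I. \<Sum>n\<in>?I. \<Sum>l\<in>?I. (f m * cnj (f l)) *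
          (root_char N (- (m * n) * c) * cnj (root_char N (- (l * n) * c))))"
    by (rule sum.swap)
  also have "\<dots> = (\<Sum>m\<in>?I. \<Sum>l\<in>?I. \<Sum>n\<in>?I. (f m * cnj (f l)) *
          (root_char N (- (m * n) * c) * cnj (root_char N (- (l * n) * c))))"
    by (rule sum.cong[OF refl], rule sum.swap)
  also have "\<dots> = (\<Sum>m\<in>?I. \<Sum>l\<in>?I. (f m * cnj (f l)) * (if m = l then of_nat N else 0))"
    by (intro sum.cong refl) (simp only: sum_distrib_left[symmetric] orth)
  also have "\<dots> = (\<Sum>m\<in>?I. of_nat N * (f m * cnj (f m)))"
    by (intro sum.cong refl) (simp add: if_distrib sum.delta mult.commute cong: if_cong)
  also have "\<dots> = complex_of_real (real N * (\<Sum>m\<in>?I. (cmod (f m))\<^sup>2))"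
    by (simp only: of_real_mult of_real_sum complex_norm_square sum_distrib_left of_real_of_nat_eq)
  finally show ?thesis by (simp only: of_real_eq_iff)
qed

lemma l2norm_power2: "(l2norm N u)\<^sup>2 = (\<Sum>m\<in>{0..<int N}. \<Sum>p\<in>UNIV. (cmod (u m $ p))\<^sup>2)"
  by (simp add: l2norm_def sum_nonneg)

lemma dft_frame_nth: "dft_frame N s m $ p = root_char N (m * s p)"
  by (simp add: dft_frame_def root_char_def mult.assoc)

lemma vdft_nth:
  "vdft N s u n $ p = (1 / sqrt (real N)) *\<^sub>R
     (\<Sum>m\<in>{0..<int N}. u m $ p * root_char N (- (m * n) * s p))"
  by (simp add: vdft_def dft_frame_nth)

text \<open>Coordinate \<open>p\<close> is a scalar transform with multiplier \<open>s p\<close>, to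
  which Parseval applies; the squared normalisation 1/N absorbs the factor \<open>N\<close>. Summing
  over \<open>p\<close> needs the coordinate sum outermost.\<close>

lemma l2norm_vdft:
  assumes "N > 0" and "\<And>p. coprime (s p) (int N)"
  shows "l2norm N (vdft N s u) = l2norm N u"
proof -
  have "(\<Sum>n\<in>{0..<int N}. (cmod (vdft N s u n $ p))\<^sup>2) = (\<Sum>m\<in>{0..<int N}. (cmod (u m $ p))\<^sup>2)" for p
  proof -
    have "(cmod (vdft N s u n $ p))\<^sup>2 =
        (cmod (\<Sum>m\<in>{0..<int N}. u m $ p * root_char N (- (m * n) * s p)))\<^sup>2 / real N" for n
      by (simp add: vdft_nth power_divide)
    then show ?thesis
      using parseval_root_char[OF assms, of "\<lambda>m. u m $ p"] assms(1)
      by (simp only: sum_divide_distrib[symmetric]) simp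
  qed
  then show ?thesis
    unfolding l2norm_def by (subst (1 2) sum.swap) simp
qed

text \<open>Modulation on the frequency side is translation on the other: x_n x_{-mn} = x_{-(m-1)n},
  and periodicity allows reindexing by one.\<close>

lemma modulation_vdft:
  assumes N: "N > 0" and u: "u \<in> l2 N"
  shows "modulation N s 1 n * vdft N s u n = vdft N s (\<lambda>m. u (m + 1)) n"
    and "modulation N s (- 1) n * vdft N s u n = vdft N s (\<lambda>m. u (m - 1)) n"
proof -
  have per: "u (m + int N) = u m" for m using u by (simp add: l2_def)
  have shift: "root_char N (n * s p) * (\<Sum>m\<in>{0..<int N}. w m $ p * root_char N (- (m * n) * s p))
     = (\<Sum>m\<in>{0..<int N}. w (m + 1) $ p * root_char N (- (m * n) * s p))"
    if w: "\<And>m. w (m + int N) = w m" for w :: "int \<Rightarrow> complex ^ 'a" and p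
  proof -
    \<comment> \<open>The summand once the outer factor is absorbed; \<open>?f (m + 1)\<close> is
      the summand of the translated function.\<close>
    let ?f = "\<lambda>m. w m $ p * root_char N (- ((m - 1) * n) * s p)"
    have "?f (m + int N) = ?f m" for m
      using root_char_add_mult[OF N, of "- ((m - 1) * n) * s p" "- (n * s p)"]
      by (simp add: w algebra_simps)
    then have "(\<Sum>m\<in>{0..<int N}. ?f (m + 1)) = (\<Sum>m\<in>{0..<int N}. ?f m)"
      by (rule sum_int_shift_periodic)
    moreover have "root_char N (n * s p) * (w m $ p * root_char N (- (m * n) * s p)) = ?f m" for m
      using root_char_add[of N "n * s p" "- (m * n) * s p"] by (simp add: algebra_simps)
    ultimately show ?thesis by (simp only: sum_distrib_left add_diff_cancel_right')
  qed
  show "modulation N s 1 n * vdft N s u n = vdft N s (\<lambda>m. u (m + 1)) n"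
    using shift[of u, OF per]
    by (simp add: vec_eq_iff vdft_nth modulation_def dft_frame_nth)
  \<comment> \<open>The second identity inverts the first: \<open>shift\<close> for the backward
    translate writes the transform of \<open>u\<close> as a character times that of the translate,
    and the opposite character cancels it.\<close>
  have per': "u (m + int N - 1) = u (m - 1)" for m
    using per[of "m - 1"] by (simp add: algebra_simps)
  have "root_char N (- (n * s p)) * root_char N (n * s p) = 1" for p
    by (simp add: root_char_add[symmetric])
  then have cancel: "root_char N (- (n * s p)) * (root_char N (n * s p) * x) = x" for p x
    by (simp flip: mult.assoc)
  show "modulation N s (- 1) n * vdft N s u n = vdft N s (\<lambda>m. u (m - 1)) n"
    using shift[of "\<lambda>m. u (m - 1)", OF per', symmetric]
    by (simp add: vec_eq_iff vdft_nth modulation_def dft_frame_nth cancel)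
qed

lemma vdft_diff: "vdft N s (\<lambda>m. u m - v m) n = vdft N s u n - vdft N s v n"
  by (simp add: vdft_def left_diff_distrib sum_subtractf scaleR_diff_right)

text \<open>Positions and coordinates are merged into one index set of pairs; the triangle
  inequality then reduces the claim to the real Cauchy-Schwarz inequality for moduli.\<close>

lemma sum_cinner_Cauchy_Schwarz:
  "(cmod (\<Sum>m\<in>{0..<int N}. cinner (v m) (w m)))\<^sup>2 \<le> (l2norm N v)\<^sup>2 * (l2norm N w)\<^sup>2"
proof -
  let ?J = "{0..<int N} \<times> (UNIV :: 'a set)"
  have "cmod (\<Sum>m\<in>{0..<int N}. cinner (v m) (w m))
      = cmod (\<Sum>(m, p)\<in>?J. v m $ p * cnj (w m $ p))"
    by (simp add: cinner_def sum.cartesian_product)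
  also have "\<dots> \<le> (\<Sum>(m, p)\<in>?J. cmod (v m $ p) * cmod (w m $ p))"
    by (rule order_trans[OF norm_sum]) (simp add: case_prod_beta norm_mult)
  finally have "(cmod (\<Sum>m\<in>{0..<int N}. cinner (v m) (w m)))\<^sup>2
      \<le> (\<Sum>x\<in>?J. cmod (v (fst x) $ snd x) * cmod (w (fst x) $ snd x))\<^sup>2"
    by (intro power_mono) (simp_all add: case_prod_beta)
  also have "\<dots> \<le> (\<Sum>x\<in>?J. (cmod (v (fst x) $ snd x))\<^sup>2) * (\<Sum>x\<in>?J. (cmod (w (fst x) $ snd x))\<^sup>2)"
    by (rule Cauchy_Schwarz_ineq_sum)
  finally show ?thesis
    by (simp add: l2norm_power2 sum.cartesian_product case_prod_beta)
qed

text \<open>Put z = \<open>u m $ p * cnj (u (m + 1) $ p)\<close>. After reindexing, the summand at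
  coordinate \<open>p\<close> is \<open>q m $ p\<close> times z minus \<open>q (m + 1) $ p\<close>
  times \<open>cnj z\<close>. With real coefficients, conjugation flips the sign of the imaginary
  part only, which gives the sum of the weights for Im and their difference for Re.\<close>

lemma sum_cinner_central_difference:
  fixes q u :: "int \<Rightarrow> complex ^ 'd::finite"
  assumes q: "q \<in> l2 N" and real: "\<forall>m p. q m $ p \<in> \<real>" and u: "u \<in> l2 N"
  shows "Im (\<Sum>m\<in>{0..<int N}. cinner (q m * u m) (u (m + 1) - u (m - 1)))
       = (\<Sum>m\<in>{0..<int N}. Im (cinner (u m) ((q m + q (m + 1)) * u (m + 1))))" (is ?Im)
    and "Re (\<Sum>m\<in>{0..<int N}. cinner (q m * u m) (u (m + 1) - u (m - 1)))
       = (\<Sum>m\<in>{0..<int N}. Re (cinner (u m) ((q m - q (m + 1)) * u (m + 1))))" (is ?Re)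
proof -
  let ?I = "{0..<int N}"
  have "u (m + int N - 1) = u (m - 1)" for m
    using u[unfolded l2_def, simplified, rule_format, of "m - 1"] by (simp add: algebra_simps)
  \<comment> \<open>Only the backward-neighbour term is reindexed; both \<open>q\<close> and
    \<open>u\<close> must be periodic for this.\<close>
  then have "(\<Sum>m\<in>?I. cinner (q (m + 1) * u (m + 1)) (u m)) = (\<Sum>m\<in>?I. cinner (q m * u m) (u (m - 1)))"
    using sum_int_shift_periodic[of "\<lambda>m. cinner (q m * u m) (u (m - 1))" N] q u
    by (simp add: l2_def)
  then have eq: "(\<Sum>m\<in>?I. cinner (q m * u m) (u (m + 1) - u (m - 1)))
      = (\<Sum>m\<in>?I. cinner (q m * u m) (u (m + 1)) - cinner (q (m + 1) * u (m + 1)) (u m))"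
    by (simp add: cinner_def right_diff_distrib sum_subtractf)
  have Im_q: "Im (q m $ p) = 0" for m p
    using real by (simp add: complex_is_Real_iff)
  have "Im (cinner (q m * u m) (u (m + 1)) - cinner (q (m + 1) * u (m + 1)) (u m))
      = Im (cinner (u m) ((q m + q (m + 1)) * u (m + 1)))" for m
    unfolding cinner_def sum_subtractf[symmetric] Im_sum
    by (rule sum.cong) (simp_all add: Im_q, simp add: algebra_simps)
  then show ?Im by (simp only: eq Im_sum)
  have "Re (cinner (q m * u m) (u (m + 1)) - cinner (q (m + 1) * u (m + 1)) (u m))
      = Re (cinner (u m) ((q m - q (m + 1)) * u (m + 1)))" for m
    unfolding cinner_def sum_subtractf[symmetric] Re_sum
    by (rule sum.cong) (simp_all add: Im_q, simp add: algebra_simps)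
  then show ?Re by (simp only: eq Re_sum)
qed

theorem theorem8p6:
  fixes N :: nat
    and s :: "'d::finite \<Rightarrow> int"
    and q u :: "int \<Rightarrow> complex ^ 'd"
  assumes "N \<ge> CARD('d)"
    and "inj (\<lambda>p. s p mod int N)"
    and "\<forall>p. gcd (s p) (int N) = 1"
    and "q \<in> l2 N"
    and "\<forall>m p. q m $ p \<in> \<real>"
    and "u \<in> l2 N"
  shows "(\<Sum>m\<in>{0..<int N}. Im (cinner (u m) ((q m + q (m + 1)) * u (m + 1))))\<^sup>2
       + (\<Sum>m\<in>{0..<int N}. Re (cinner (u m) ((q m - q (m + 1)) * u (m + 1))))\<^sup>2
       \<le> (l2norm N (\<lambda>m. q m * u m))\<^sup>2
         * (l2norm N (\<lambda>n. (modulation N s 1 n - modulation N s (- 1) n) * vdft N s u n))\<^sup>2"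
proof -
  have N: "N > 0"
    using assms(1) zero_less_card_finite[where 'a='d] by linarith
  let ?v = "\<lambda>m. u (m + 1) - u (m - 1)"
  have "(\<lambda>n. (modulation N s 1 n - modulation N s (- 1) n) * vdft N s u n) = vdft N s ?v"
    by (simp add: fun_eq_iff left_diff_distrib modulation_vdft[OF N assms(6)] vdft_diff)
  moreover have "l2norm N (vdft N s ?v) = l2norm N ?v"
    using assms(3) by (intro l2norm_vdft[OF N]) (simp add: coprime_iff_gcd_eq_1)
  moreover have "(cmod (\<Sum>m\<in>{0..<int N}. cinner (q m * u m) (?v m)))\<^sup>2
      \<le> (l2norm N (\<lambda>m. q m * u m))\<^sup>2 * (l2norm N ?v)\<^sup>2"
    by (rule sum_cinner_Cauchy_Schwarz)
  \<comment> \<open>The squared modulus splits as Re squared plus Im squared. \<open>Re_sum\<close>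
    and \<open>Im_sum\<close> are disabled so that Re and Im stay outside the sum, as the central
    difference identities require.\<close>
  ultimately show ?thesis
    by (simp add: cmod_power2 sum_cinner_central_difference[OF assms(4-6)] add.commute
        del: Re_sum Im_sum)
qed

end
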